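(* Let $a>0$, let $$\Omega_a=\left\{(z_1,z_2)\in\mathbb{C}^2 : |z_2|\le\exp\!\left(\tfrac{|z_1|^2}{a}-a\right)\right\},\qquad E=\{(z_1,z_2)\in\mathbb{C}^2 : z_2=0\}.$$ Then on the domain $\Omega_a-E$ there exists a strictly plurisuperharmonic function $\psi_a$ with no critical points satisfying $\psi_a^{-1}(0)=\partial\Omega_a$ and $\psi_a^{-1}(\mathopen]-\infty,0\mathclose])=\Omega_a-E$.
   Context: A smooth real function $\psi$ on a complex manifold is strictly plurisuperharmonic if its complex Hessian $\sum_{\alpha,\beta}\frac{\partial^2\psi}{\partial z_\alpha\partial\bar z_\beta}\,dz_\alpha\otimes d\bar z_\beta$ is negative definite at every point, i.e. $-\psi$ is strictly plurisubharmonic. Here $\partial\Omega_a=\{|z_2|=\exp(|z_1|^2/a-a)\}$, and $\Omega_a-E$ is a manifold with boundary $\partial\Omega_a$. *)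

theory Defs
  imports "HOL-Analysis.Analysis"
begin

primrec Ck_on :: "nat \<Rightarrow> ('a::real_normed_vector \<Rightarrow> 'b::real_normed_vector) \<Rightarrow> 'a set \<Rightarrow> bool" where
  "Ck_on 0 f U \<longleftrightarrow> continuous_on U f"
| "Ck_on (Suc k) f U \<longleftrightarrow>
     (\<forall>x\<in>U. f differentiable (at x)) \<and>
     (\<forall>v. Ck_on k (\<lambda>x. frechet_derivative f (at x) v) U)"

text \<open>
  Smoothness on a set that need not be open, such as a domain together with its boundary, means
  smoothness on some open neighbourhood. For a closed domain with boundary in an open subset of
  \<open>\<complex>\<^sup>n\<close> these are exactly the functions that are smooth up to the boundary: a function on
  the domain that extends smoothly near each of its points has a smooth extension to a
  neighbourhood, and a total function \<open>f\<close> may take the values of that extension. Derivatives at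
  boundary points do not depend on the extension when the set lies in the closure of its interior.
\<close>

definition smooth_on :: "('a::real_normed_vector \<Rightarrow> 'b::real_normed_vector) \<Rightarrow> 'a set \<Rightarrow> bool" where
  "smooth_on f S \<longleftrightarrow> (\<exists>U. open U \<and> S \<subseteq> U \<and> (\<forall>k. Ck_on k f U))"

definition critical_point :: "('a::real_normed_vector \<Rightarrow> real) \<Rightarrow> 'a \<Rightarrow> bool" where
  "critical_point f x \<longleftrightarrow> (f has_derivative (\<lambda>v. 0)) (at x)"

text \<open>
  Wirtinger derivatives: with \<open>z\<^sub>\<alpha> = x\<^sub>\<alpha> + \<i> y\<^sub>\<alpha>\<close>, the partial derivatives in
  \<open>x\<^sub>\<alpha>\<close> and \<open>y\<^sub>\<alpha>\<close> are the real directional derivatives along \<open>axis \<alpha> 1\<close> and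
  \<open>axis \<alpha> \<i>\<close>.
\<close>

definition dz :: "'n \<Rightarrow> (complex ^ 'n::finite \<Rightarrow> complex) \<Rightarrow> complex ^ 'n \<Rightarrow> complex" where
  "dz \<alpha> f z =
     (frechet_derivative f (at z) (axis \<alpha> 1) - \<i> * frechet_derivative f (at z) (axis \<alpha> \<i>)) / 2"

definition dzbar :: "'n \<Rightarrow> (complex ^ 'n::finite \<Rightarrow> complex) \<Rightarrow> complex ^ 'n \<Rightarrow> complex" where
  "dzbar \<alpha> f z =
     (frechet_derivative f (at z) (axis \<alpha> 1) + \<i> * frechet_derivative f (at z) (axis \<alpha> \<i>)) / 2"

definition complex_hessian :: "(complex ^ 'n::finite \<Rightarrow> real) \<Rightarrow> complex ^ 'n \<Rightarrow> complex ^ 'n ^ 'n" where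
  "complex_hessian \<psi> z = (\<chi> \<alpha> \<beta>. dz \<alpha> (dzbar \<beta> (\<lambda>w. complex_of_real (\<psi> w))) z)"

text \<open>
  Only applied to Hermitian matrices, for which the sum is real. The complex Hessian of a smooth
  real function is Hermitian by the symmetry of second derivatives.
\<close>

definition negative_definite :: "complex ^ 'n ^ 'n::finite \<Rightarrow> bool" where
  "negative_definite H \<longleftrightarrow>
     (\<forall>v. v \<noteq> 0 \<longrightarrow> Re (\<Sum>\<alpha>\<in>UNIV. \<Sum>\<beta>\<in>UNIV. H $ \<alpha> $ \<beta> * (v $ \<alpha>) * cnj (v $ \<beta>)) < 0)"

definition strictly_plurisuperharmonic_on :: "(complex ^ 'n::finite \<Rightarrow> real) \<Rightarrow> (complex ^ 'n) set \<Rightarrow> bool" where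
  "strictly_plurisuperharmonic_on \<psi> S \<longleftrightarrow>
     smooth_on \<psi> S \<and> (\<forall>z\<in>S. negative_definite (complex_hessian \<psi> z))"

definition Omega :: "real \<Rightarrow> (complex ^ 2) set" where
  "Omega a = {z. cmod (z $ 2) \<le> exp ((cmod (z $ 1))\<^sup>2 / a - a)}"

definition boundary_Omega :: "real \<Rightarrow> (complex ^ 2) set" where
  "boundary_Omega a = {z. cmod (z $ 2) = exp ((cmod (z $ 1))\<^sup>2 / a - a)}"

definition E :: "(complex ^ 2) set" where
  "E = {z. z $ 2 = 0}"

end

theory Submission
  imports Defs
begin

text \<open>
  The function \<open>\<rho> = log |z\<^sub>2| - |z\<^sub>1|\<^sup>2 / a + a\<close> defines the domain, and its complex Hessian is
  negative in the \<open>z\<^sub>1\<close>-direction but degenerate in the \<open>z\<^sub>2\<close>-direction. Since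
  \<open>\<partial>\<rho>/\<partial>z\<^sub>2 \<noteq> 0\<close>, composing with an increasing strictly concave function of the real line
  makes the Hessian negative definite without creating critical points. The choice
  \<open>\<psi> = 1 - exp (- 2\<rho>) = 1 - P\<close> with \<open>P = exp (2 |z\<^sub>1|\<^sup>2 / a - 2a) / |z\<^sub>2|\<^sup>2\<close> gives the
  Hermitian form \<open>- P (2/a |v\<^sub>1|\<^sup>2 + |2/a cnj z\<^sub>1 v\<^sub>1 - v\<^sub>2 / z\<^sub>2|\<^sup>2)\<close>.
\<close>

lemma Ck_on_cong:
  assumes "open U" "\<And>x. x \<in> U \<Longrightarrow> f x = g x" "Ck_on k f U"
  shows "Ck_on k g U"
  using assms(2,3)
proof (induction k arbitrary: f g)
  case 0
  then show ?case using continuous_on_cong by fastforce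
next
  case (Suc k)
  have D: "(g has_derivative frechet_derivative f (at x)) (at x)" if "x \<in> U" for x
  proof (rule has_derivative_transform_within_open[OF _ assms(1) that Suc.prems(1)])
    show "(f has_derivative frechet_derivative f (at x)) (at x)"
      using Suc.prems(2) that by (simp add: frechet_derivative_works)
  qed
  have "Ck_on k (\<lambda>x. frechet_derivative g (at x) v) U" for v
  proof (rule Suc.IH)
    show "Ck_on k (\<lambda>x. frechet_derivative f (at x) v) U"
      using Suc.prems(2) by simp
    show "frechet_derivative f (at x) v = frechet_derivative g (at x) v" if "x \<in> U" for x
      using frechet_derivative_at[OF D[OF that]] by simp
  qed
  then show ?case using D by (auto simp: differentiable_def)
qed

lemma Ck_on_SucI:
  assumes "open U" "\<And>x. x \<in> U \<Longrightarrow> (f has_derivative f' x) (at x)"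
    and "\<And>v. Ck_on k (\<lambda>x. f' x v) U"
  shows "Ck_on (Suc k) f U"
proof -
  have "Ck_on k (\<lambda>x. frechet_derivative f (at x) v) U" for v
    using frechet_derivative_at[OF assms(2)] by (intro Ck_on_cong[OF assms(1) _ assms(3)[of v]]) metis
  then show ?thesis using assms(2) by (auto simp: differentiable_def)
qed

lemma Ck_on_Suc_has_derivative:
  assumes "Ck_on (Suc k) f U" "x \<in> U"
  shows "(f has_derivative frechet_derivative f (at x)) (at x)"
  using assms by (simp add: frechet_derivative_works)

lemma Ck_on_Suc_derivative:
  "Ck_on (Suc k) f U \<Longrightarrow> Ck_on k (\<lambda>x. frechet_derivative f (at x) v) U"
  by simp

lemma Ck_on_Suc_imp: "Ck_on (Suc k) f U \<Longrightarrow> Ck_on k f U"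
proof (induction k arbitrary: f)
  case 0
  then show ?case
    by (simp add: differentiable_imp_continuous_on differentiable_at_imp_differentiable_on)
next
  case (Suc k)
  then show ?case by (metis Ck_on.simps(2))
qed

lemma Ck_on_const: "open U \<Longrightarrow> Ck_on k (\<lambda>x. c) U"
proof (induction k arbitrary: c)
  case (Suc k)
  show ?case
    by (rule Ck_on_SucI[OF Suc.prems has_derivative_const]) (rule Suc.IH[OF Suc.prems])
qed simp

lemma Ck_on_linear:
  assumes "open U" "bounded_linear f"
  shows "Ck_on k f U"
proof (cases k)
  case 0
  then show ?thesis using assms linear_continuous_on by auto
next
  case (Suc m)
  have "(f has_derivative f) (at x)" for x
    using assms(2) bounded_linear_imp_has_derivative by blast
  then show ?thesis unfolding Suc
    by (rule Ck_on_SucI[OF assms(1)]) (rule Ck_on_const[OF assms(1)])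
qed

lemma Ck_on_add:
  assumes "open U"
  shows "Ck_on k f U \<Longrightarrow> Ck_on k g U \<Longrightarrow> Ck_on k (\<lambda>x. f x + g x) U"
proof (induction k arbitrary: f g)
  case 0
  then show ?case by (auto intro: continuous_intros)
next
  case (Suc k)
  show ?case
    by (rule Ck_on_SucI[OF assms has_derivative_add])
      (rule Suc.prems[THEN Ck_on_Suc_has_derivative] Suc.IH
        Suc.prems[THEN Ck_on_Suc_derivative] | assumption)+
qed

lemma (in bounded_bilinear) Ck_on_prod:
  assumes "open U"
  shows "Ck_on k f U \<Longrightarrow> Ck_on k g U \<Longrightarrow> Ck_on k (\<lambda>x. prod (f x) (g x)) U"
proof (induction k arbitrary: f g)
  case 0
  then show ?case by (auto intro: continuous_on)
next
  case (Suc k)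
  show ?case
    by (rule Ck_on_SucI[OF assms FDERIV])
      (rule Suc.prems[THEN Ck_on_Suc_has_derivative] Ck_on_add[OF assms] Suc.IH
        Suc.prems[THEN Ck_on_Suc_derivative] Suc.prems[THEN Ck_on_Suc_imp] | assumption)+
qed

lemmas Ck_on_mult = bounded_bilinear.Ck_on_prod[OF bounded_bilinear_mult]
lemmas Ck_on_inner = bounded_bilinear.Ck_on_prod[OF bounded_bilinear_inner]

lemma Ck_on_exp:
  fixes f :: "'a::real_normed_vector \<Rightarrow> real"
  assumes "open U"
  shows "Ck_on k f U \<Longrightarrow> Ck_on k (\<lambda>x. exp (f x)) U"
proof (induction k)
  case 0
  then show ?case by (auto intro: continuous_intros)
next
  case (Suc k)
  show ?case
  proof (rule Ck_on_SucI[OF assms])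
    show "((\<lambda>x. exp (f x)) has_derivative (\<lambda>v. exp (f x) * frechet_derivative f (at x) v)) (at x)"
      if "x \<in> U" for x
      using has_derivative_exp[OF Ck_on_Suc_has_derivative[OF Suc.prems that]]
      by (simp add: mult.commute)
    show "Ck_on k (\<lambda>x. exp (f x) * frechet_derivative f (at x) v) U" for v
      by (intro Ck_on_mult assms Suc.IH Ck_on_Suc_imp[OF Suc.prems] Ck_on_Suc_derivative[OF Suc.prems])
  qed
qed

lemma Ck_on_inverse:
  fixes f :: "'a::real_normed_vector \<Rightarrow> real"
  assumes "open U" and nz: "\<And>x. x \<in> U \<Longrightarrow> f x \<noteq> 0"
  shows "Ck_on k f U \<Longrightarrow> Ck_on k (\<lambda>x. inverse (f x)) U"
proof (induction k)
  case 0
  then show ?case using nz by (auto intro: continuous_intros)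
next
  case (Suc k)
  show ?case
  proof (rule Ck_on_SucI[OF assms(1)])
    show "((\<lambda>x. inverse (f x)) has_derivative
        (\<lambda>v. (- 1) * (inverse (f x) * frechet_derivative f (at x) v * inverse (f x)))) (at x)"
      if "x \<in> U" for x
      using Deriv.has_derivative_inverse[OF nz Ck_on_Suc_has_derivative[OF Suc.prems], OF that that]
      by simp
    show "Ck_on k (\<lambda>x. (- 1) * (inverse (f x) * frechet_derivative f (at x) v * inverse (f x))) U"
      for v
      by (intro Ck_on_mult Ck_on_const assms(1) Suc.IH Ck_on_Suc_imp[OF Suc.prems]
          Ck_on_Suc_derivative[OF Suc.prems])
  qed
qed

lemma dz_eq:
  assumes "(f has_derivative f') (at z)"
  shows "dz \<alpha> f z = (f' (axis \<alpha> 1) - \<i> * f' (axis \<alpha> \<i>)) / 2"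
  using frechet_derivative_at[OF assms] by (simp add: dz_def)

lemma dzbar_eq:
  assumes "(f has_derivative f') (at z)"
  shows "dzbar \<alpha> f z = (f' (axis \<alpha> 1) + \<i> * f' (axis \<alpha> \<i>)) / 2"
  using frechet_derivative_at[OF assms] by (simp add: dzbar_def)

lemma dz_cong_open:
  assumes "open U" "z \<in> U" "\<And>w. w \<in> U \<Longrightarrow> g w = f w" "(f has_derivative f') (at z)"
  shows "dz \<alpha> g z = (f' (axis \<alpha> 1) - \<i> * f' (axis \<alpha> \<i>)) / 2"
  by (rule dz_eq, rule has_derivative_transform_within_open[OF assms(4,1,2)]) (simp add: assms(3))

definition P :: "real \<Rightarrow> complex ^ 2 \<Rightarrow> real" where
  "P a z = exp (2 / a * (z $ 1 \<bullet> z $ 1) + - 2 * a) * inverse (z $ 2 \<bullet> z $ 2)"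

definition L :: "real \<Rightarrow> complex ^ 2 \<Rightarrow> complex ^ 2 \<Rightarrow> real" where
  "L a z v = 4 / a * (z $ 1 \<bullet> v $ 1) - 2 * (z $ 2 \<bullet> v $ 2) / (z $ 2 \<bullet> z $ 2)"

lemma open_compl_E: "open (- E)"
proof -
  have "closed {z :: complex ^ 2. z $ 2 = 0}"
    by (intro closed_Collect_eq continuous_intros)
  then show ?thesis by (simp add: E_def open_Compl)
qed

lemma P_pos: "z \<notin> E \<Longrightarrow> P a z > 0"
  by (simp add: P_def E_def)

lemma Ck_on_P: "Ck_on k (P a) (- E)"
  unfolding P_def
  by (intro Ck_on_mult Ck_on_exp Ck_on_inverse Ck_on_add Ck_on_const Ck_on_inner Ck_on_linear
      open_compl_E bounded_linear_vec_nth) (simp add: E_def)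

lemma has_derivative_P:
  assumes "z \<notin> E"
  shows "(P a has_derivative (\<lambda>v. P a z * L a z v)) (at z)"
  unfolding P_def L_def
  by (rule derivative_eq_intros bounded_linear.has_derivative[OF bounded_linear_vec_nth] refl
      | use assms in \<open>force simp: E_def\<close>)+
    (use assms in \<open>simp add: fun_eq_iff E_def field_simps inner_commute\<close>)

lemma has_derivative_psi:
  assumes "z \<notin> E"
  shows "((\<lambda>z. 1 - P a z) has_derivative (\<lambda>v. - (P a z * L a z v))) (at z)"
  using has_derivative_diff[OF has_derivative_const has_derivative_P[OF assms]] by simp

lemma cnj_inner_self: "complex_of_real (w \<bullet> w) = w * cnj w"
  by (simp add: complex_mult_cnj inner_complex_def power2_eq_square)

lemma inner_one_ii: "w \<bullet> (1 :: complex) = Re w" "w \<bullet> \<i> = Im w"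
  by (simp_all add: inner_complex_def)

lemma dzbar_psi:
  assumes "z \<notin> E"
  shows "dzbar 1 (\<lambda>w. complex_of_real (1 - P a w)) z = of_real (P a z) * (of_real (- 2 / a) * z $ 1)"
    and "dzbar 2 (\<lambda>w. complex_of_real (1 - P a w)) z = of_real (P a z) * inverse (cnj (z $ 2))"
proof -
  note D = dzbar_eq[OF bounded_linear.has_derivative[OF bounded_linear_of_real has_derivative_psi[OF assms]]]
  have nz: "z $ 2 \<noteq> 0" using assms by (simp add: E_def)
  show "dzbar 1 (\<lambda>w. complex_of_real (1 - P a w)) z = of_real (P a z) * (of_real (- 2 / a) * z $ 1)"
    unfolding D L_def by (simp add: axis_def complex_eq_iff inner_one_ii)
  have "dzbar 2 (\<lambda>w. complex_of_real (1 - P a w)) z = of_real (P a z) * (z $ 2 / of_real (z $ 2 \<bullet> z $ 2))"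
    unfolding D L_def by (simp add: axis_def complex_eq_iff inner_one_ii)
  also have "z $ 2 / of_real (z $ 2 \<bullet> z $ 2) = inverse (cnj (z $ 2))"
    unfolding cnj_inner_self using nz by (simp add: field_simps)
  finally show "dzbar 2 (\<lambda>w. complex_of_real (1 - P a w)) z = of_real (P a z) * inverse (cnj (z $ 2))" .
qed

lemma wirtinger_L:
  assumes "z \<notin> E"
  shows "complex_of_real (L a z (axis 1 1)) - \<i> * of_real (L a z (axis 1 \<i>)) = of_real (4 / a) * cnj (z $ 1)"
    and "complex_of_real (L a z (axis 2 1)) - \<i> * of_real (L a z (axis 2 \<i>)) = - 2 / z $ 2"
proof -
  have nz: "z $ 2 \<noteq> 0" using assms by (simp add: E_def)
  show "complex_of_real (L a z (axis 1 1)) - \<i> * of_real (L a z (axis 1 \<i>)) = of_real (4 / a) * cnj (z $ 1)"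
    unfolding L_def by (simp add: axis_def complex_eq_iff inner_one_ii)
  have "complex_of_real (L a z (axis 2 1)) - \<i> * of_real (L a z (axis 2 \<i>))
      = - 2 * cnj (z $ 2) / of_real (z $ 2 \<bullet> z $ 2)"
    unfolding L_def by (simp add: axis_def complex_eq_iff inner_one_ii)
  also have "\<dots> = - 2 / z $ 2"
    unfolding cnj_inner_self using nz by (simp add: field_simps)
  finally show "complex_of_real (L a z (axis 2 1)) - \<i> * of_real (L a z (axis 2 \<i>)) = - 2 / z $ 2" .
qed

lemma dz_P_times:
  assumes "z \<notin> E" "(g has_derivative g') (at z)" "\<And>w. w \<notin> E \<Longrightarrow> f w = of_real (P a w) * g w"
  shows "dz \<alpha> f z = of_real (P a z) *
    ((complex_of_real (L a z (axis \<alpha> 1)) - \<i> * of_real (L a z (axis \<alpha> \<i>))) / 2 * g z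
      + (g' (axis \<alpha> 1) - \<i> * g' (axis \<alpha> \<i>)) / 2)"
  using assms
  by (subst dz_cong_open[OF open_compl_E _ _ has_derivative_mult[OF
        bounded_linear.has_derivative[OF bounded_linear_of_real has_derivative_P] assms(2)]])
    (auto simp: field_simps)

lemma complex_hessian_psi:
  fixes a :: real
  assumes "z \<notin> E"
  defines "H \<equiv> complex_hessian (\<lambda>w. 1 - P a w) z"
  shows "H $ 1 $ 1 = - of_real (P a z) * (of_real (2 / a) + of_real (2 / a)^2 * (z $ 1 * cnj (z $ 1)))"
    and "H $ 2 $ 1 = of_real (P a z) * (of_real (2 / a) * z $ 1 / z $ 2)"
    and "H $ 1 $ 2 = of_real (P a z) * (of_real (2 / a) * cnj (z $ 1) / cnj (z $ 2))"
    and "H $ 2 $ 2 = - of_real (P a z) / (z $ 2 * cnj (z $ 2))"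
proof -
  have nz: "z $ 2 \<noteq> 0" using assms by (simp add: E_def)
  have g1: "((\<lambda>w :: complex ^ 2. of_real (- 2 / a) * w $ 1) has_derivative
      (\<lambda>v. of_real (- 2 / a) * v $ 1)) (at z)"
    by (intro bounded_linear_imp_has_derivative bounded_linear_mult_right[THEN bounded_linear_compose]
        bounded_linear_vec_nth)
  have "((\<lambda>w :: complex ^ 2. cnj (w $ 2)) has_derivative (\<lambda>v. cnj (v $ 2))) (at z)"
    by (intro bounded_linear_imp_has_derivative bounded_linear_cnj[THEN bounded_linear_compose]
        bounded_linear_vec_nth)
  then have g2: "((\<lambda>w :: complex ^ 2. inverse (cnj (w $ 2))) has_derivative
      (\<lambda>v. - (inverse (cnj (z $ 2)) * cnj (v $ 2) * inverse (cnj (z $ 2))))) (at z)"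
    using nz by (intro Deriv.has_derivative_inverse) auto
  note D1 = dz_P_times[where f = "dzbar 1 (\<lambda>w. complex_of_real (1 - P a w))",
      OF assms(1) g1 dzbar_psi(1)]
  note D2 = dz_P_times[where f = "dzbar 2 (\<lambda>w. complex_of_real (1 - P a w))",
      OF assms(1) g2 dzbar_psi(2)]
  note defs = H_def complex_hessian_def
  note W = wirtinger_L[OF assms(1)]
  show "H $ 1 $ 1 = - of_real (P a z) * (of_real (2 / a) + of_real (2 / a)^2 * (z $ 1 * cnj (z $ 1)))"
    by (simp only: defs vec_lambda_beta, subst D1, assumption, simp only: W) (simp add: axis_def field_simps power2_eq_square)
  show "H $ 2 $ 1 = of_real (P a z) * (of_real (2 / a) * z $ 1 / z $ 2)"
    by (simp only: defs vec_lambda_beta, subst D1, assumption, simp only: W) (simp add: axis_def field_simps power2_eq_square)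
  show "H $ 1 $ 2 = of_real (P a z) * (of_real (2 / a) * cnj (z $ 1) / cnj (z $ 2))"
    by (simp only: defs vec_lambda_beta, subst D2, assumption, simp only: W) (simp add: axis_def field_simps power2_eq_square)
  show "H $ 2 $ 2 = - of_real (P a z) / (z $ 2 * cnj (z $ 2))"
    by (simp only: defs vec_lambda_beta, subst D2, assumption, simp only: W) (simp add: axis_def field_simps power2_eq_square)
qed

lemma negative_definite_psi:
  assumes "a > 0" "z \<notin> E"
  shows "negative_definite (complex_hessian (\<lambda>w. 1 - P a w) z)"
  unfolding negative_definite_def
proof (intro allI impI)
  fix v :: "complex ^ 2"
  assume v: "v \<noteq> 0"
  have nz: "z $ 2 \<noteq> 0" using assms by (simp add: E_def)
  define H where "H = complex_hessian (\<lambda>w. 1 - P a w) z"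
  define B where "B = of_real (2 / a) * cnj (z $ 1) * v $ 1 - v $ 2 / z $ 2"
  have "(\<Sum>\<alpha>\<in>UNIV. \<Sum>\<beta>\<in>UNIV. H $ \<alpha> $ \<beta> * (v $ \<alpha>) * cnj (v $ \<beta>))
      = - of_real (P a z) * (of_real (2 / a) * (v $ 1 * cnj (v $ 1)) + B * cnj B)"
    using nz \<open>a > 0\<close>
    by (simp add: sum_2 H_def complex_hessian_psi[OF assms(2)] B_def)
      (simp add: field_simps power2_eq_square)
  also have "\<dots> = of_real (- P a z * (2 / a * (cmod (v $ 1))\<^sup>2 + (cmod B)\<^sup>2))"
    by (simp flip: complex_norm_square)
  finally have *: "Re (\<Sum>\<alpha>\<in>UNIV. \<Sum>\<beta>\<in>UNIV. H $ \<alpha> $ \<beta> * (v $ \<alpha>) * cnj (v $ \<beta>))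
      = - P a z * (2 / a * (cmod (v $ 1))\<^sup>2 + (cmod B)\<^sup>2)"
    by simp
  have "2 / a * (cmod (v $ 1))\<^sup>2 + (cmod B)\<^sup>2 > 0"
  proof (cases "v $ 1 = 0")
    case True
    then have "v $ 2 \<noteq> 0" using v by (auto simp: vec_eq_iff forall_2)
    then show ?thesis using True nz by (simp add: B_def)
  next
    case False
    then show ?thesis using \<open>a > 0\<close> by (intro add_pos_nonneg) auto
  qed
  then show "Re (\<Sum>\<alpha>\<in>UNIV. \<Sum>\<beta>\<in>UNIV. complex_hessian (\<lambda>w. 1 - P a w) z $ \<alpha> $ \<beta>
      * (v $ \<alpha>) * cnj (v $ \<beta>)) < 0"
    using P_pos[OF assms(2)] unfolding H_def[symmetric] * by (simp add: mult_pos_pos)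
qed

lemma not_critical_psi:
  assumes "z \<notin> E"
  shows "\<not> critical_point (\<lambda>w. 1 - P a w) z"
proof
  assume "critical_point (\<lambda>w. 1 - P a w) z"
  then have "(\<lambda>v. 0) = (\<lambda>v. - (P a z * L a z v))"
    unfolding critical_point_def using has_derivative_psi[OF assms] by (rule has_derivative_unique)
  then have "P a z * L a z (axis 2 (z $ 2)) = 0"
    by (metis neg_equal_0_iff_equal)
  moreover have "L a z (axis 2 (z $ 2)) = - 2"
    using assms by (simp add: L_def axis_def E_def)
  ultimately show False using P_pos[OF assms, of a] by simp
qed

lemma P_eq:
  "P a z = (exp ((cmod (z $ 1))\<^sup>2 / a - a) / cmod (z $ 2))\<^sup>2"
proof -
  have "2 / a * (z $ 1 \<bullet> z $ 1) + - 2 * a = 2 * ((cmod (z $ 1))\<^sup>2 / a - a)"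
    by (simp add: dot_square_norm algebra_simps)
  then show ?thesis
    unfolding P_def by (simp only: exp_double) (simp add: dot_square_norm power_divide divide_inverse power_mult_distrib power_inverse)
qed

theorem proposition2p11:
  fixes a :: real
  assumes "a > 0"
  shows "\<exists>\<psi> :: complex ^ 2 \<Rightarrow> real.
           strictly_plurisuperharmonic_on \<psi> (Omega a - E) \<and>
           (\<forall>z \<in> Omega a - E. \<not> critical_point \<psi> z) \<and>
           {z \<in> Omega a - E. \<psi> z = 0} = boundary_Omega a \<and>
           {z \<in> Omega a - E. \<psi> z \<in> {..0}} = Omega a - E"
proof (intro exI conjI ballI)
  let ?\<psi> = "\<lambda>z. 1 - P a z"
  have "Ck_on k (\<lambda>z. 1 + - 1 * P a z) (- E)" for k
    by (intro Ck_on_add Ck_on_mult Ck_on_const Ck_on_P open_compl_E)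
  then have "smooth_on ?\<psi> (Omega a - E)"
    unfolding smooth_on_def using open_compl_E by (intro exI[of _ "- E"]) auto
  then show "strictly_plurisuperharmonic_on ?\<psi> (Omega a - E)"
    using negative_definite_psi[OF assms] by (simp add: strictly_plurisuperharmonic_on_def)
  show "\<not> critical_point ?\<psi> z" if "z \<in> Omega a - E" for z
    using not_critical_psi that by simp
  have boundary: "boundary_Omega a \<subseteq> Omega a - E"
    by (auto simp: boundary_Omega_def Omega_def E_def)
  have "1 - P a z = 0 \<longleftrightarrow> z \<in> boundary_Omega a" if "z \<notin> E" for z
    using that unfolding P_eq boundary_Omega_def E_def
    by (auto simp: power2_eq_1_iff divide_simps)
  then show "{z \<in> Omega a - E. ?\<psi> z = 0} = boundary_Omega a"
    using boundary by blast
  have "P a z \<ge> 1" if "z \<in> Omega a" "z \<notin> E" for z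
    using that unfolding P_eq Omega_def E_def
    by (intro one_le_power) simp
  then show "{z \<in> Omega a - E. ?\<psi> z \<in> {..0}} = Omega a - E"
    by auto
qed

end
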